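(* Let the uncertainty $\boldsymbol\Delta$ satisfy a finite-horizon IQC with terminal cost for the multiplier class $\Psi^*\boldsymbol P\Psi$. Suppose there exist some $P\in\boldsymbol P$, a corresponding terminal cost matrix $Z=Z^T$ (that is, a symmetric $Z$ for which the inequality in the definition of an IQC with terminal cost holds for this $P$), and a symmetric $X=\begin{pmatrix}X_1&X_{12}\\ X_{12}^T&X_2\end{pmatrix}$ (with $X_1$ of the size of $A_\Psi$ and $X_2$ of the size of $A$) such that $$\begin{pmatrix}X_1+Z&X_{12}\\ X_{12}^T&X_2\end{pmatrix}\succ0$$ and $$\begin{pmatrix}\mathcal A&\mathcal B\\ I&0\end{pmatrix}^T\begin{pmatrix}0&X\\ X&0\end{pmatrix}\begin{pmatrix}\mathcal A&\mathcal B\\ I&0\end{pmatrix}+\begin{pmatrix}\mathcal C&\mathcal D\end{pmatrix}^TP\begin{pmatrix}\mathcal C&\mathcal D\end{pmatrix}+\begin{pmatrix}0&C_e&D_e&D_{ed}\\ 0&0&0&I\end{pmatrix}^TP_p\begin{pmatrix}0&C_e&D_e&D_{ed}\\ 0&0&0&I\end{pmatrix}\prec0 .$$ Then $E(X,Z):=X_2-X_{12}^T(X_1+Z)^{-1}X_{12}\succ0$ and all trajectories of the uncertain interconnection $$\dot x=Ax+Bw+B_dd,\quad z=Cx+Dw+D_dd,\quad e=C_ex+D_ew+D_{ed}d,\quad w\in\boldsymbol\Delta(z)$$ satisfy $$x(T)^TE(X,Z)x(T)+\int_0^T\begin{pmatrix}e(t)\\ d(t)\end{pmatrix}^TP_p\begin{pmatrix}e(t)\\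 d(t)\end{pmatrix}dt\le x(0)^TX_2x(0)\quad\text{for all }T\ge0 .$$ Therefore, robust quadratic performance holds, i.e., there exists $\gamma_p>0$ such that all trajectories of the interconnection satisfy $$\int_0^T\begin{pmatrix}e(t)\\ d(t)\end{pmatrix}^TP_p\begin{pmatrix}e(t)\\ d(t)\end{pmatrix}dt\le\gamma_p\|x(0)\|^2\quad\text{for all }T\ge0 .$$ Moreover, the interconnection for $d=0$ (equivalently, the loop $\dot x=Ax+Bw$, $z=Cx+Dw$, $w\in\boldsymbol\Delta(z)$, $x(0)=x_0$) is robustly stable, i.e., there exists $\gamma>0$ such that all its responses satisfy $\int_0^T\|x(t)\|^2dt+\int_0^T\|w(t)\|^2dt\le\gamma^2\|x_0\|^2$ for all $T\ge0$ and all $x_0\in\mathbb R^n$.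
   Context: Signals: $\mathcal S^m$ is the set of all $u:[0,\infty)\to\mathbb R^m$ that are piecewise continuous and right-continuous. State trajectories of differential equations are continuous and have a right-derivative (denoted by a dot) at every $t\ge0$ which, as a function of $t$, belongs to the corresponding $\mathcal S^n$. All real matrices $A\in\mathbb R^{n\times n}$, $B$, $B_d$, $C$, $D$, $D_d$, $C_e$, $D_e$, $D_{ed}$ are given and of compatible dimensions, with $w(t)\in\mathbb R^m$, $z(t)\in\mathbb R^k$. The uncertainty $\boldsymbol\Delta$ is a multivalued map assigning to each $z\in\mathcal S^k$ a set $\boldsymbol\Delta(z)\subset\mathcal S^m$. Trajectories (responses) are all tuples of signals in these spaces satisfying the equations (with $d$ any piecewise continuous, right-continuous disturbance); no existence or uniqueness is assumed. Performance matrix: $P_p=\begin{pmatrix}Q_p&S_p\\ S_p^T&R_p\end{pmatrix}$ is real symmetric, partitioned compatibly with the signals $e$, $d$, and $Q_p\succeq0$. Filter: $\Psi=(\Psi_1\ \Psi_2)$ is a transfer matrix of dimension $p\times(k+m)$ with a fixed state-space realization; $v=\Psi_1z+\Psi_2w$ is defined by $\dot\xi=A_\Psi\xi+B_{\Psi_1}z+B_{\Psi_2}w$, $\xi(0)=0$, $v=C_\Psi\xi+D_{\Psi_1}z+D_{\Psi_2}w$. $\boldsymbol P$ is a set of real symmetric $p\times p$ matrices. IQC with terminal cost: $\boldsymbol\Delta$ satisfies a (finite-horizon) IQC with terminal cost for the multiplier class $\Psi^*\boldsymbol P\Psi$ if for every $P\in\boldsymbol P$ there exists a terminal cost matrix $Z=Z^T$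 such that $\int_0^Tv(t)^TPv(t)\,dt-\xi(T)^TZ\xi(T)\ge0$ for all $T\ge0$ along all filtered signals $v=\Psi_1z+\Psi_2w$ with $(w,z)\in\mathcal S^m\times\mathcal S^k$ and $w\in\boldsymbol\Delta(z)$. Matrices of the filtered system (state $(\xi,x)$, input $(w,d)$): $$\mathcal A=\begin{pmatrix}A_\Psi&B_{\Psi_1}C\\ 0&A\end{pmatrix},\ \mathcal B=\begin{pmatrix}B_{\Psi_1}D+B_{\Psi_2}&B_{\Psi_1}D_d\\ B&B_d\end{pmatrix},\ \mathcal C=\begin{pmatrix}C_\Psi&D_{\Psi_1}C\end{pmatrix},\ \mathcal D=\begin{pmatrix}D_{\Psi_1}D+D_{\Psi_2}&D_{\Psi_1}D_d\end{pmatrix}.$$ The zero column blocks in $\begin{pmatrix}0&C_e&D_e&D_{ed}\\ 0&0&0&I\end{pmatrix}$ are such that the column partition is compatible with $(\xi,x,w,d)$. $M\succ0$, $M\succeq0$, $M\prec0$ mean symmetric and positive definite, positive semidefinite, negative definite. *)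

theory Defs
  imports "HOL-Analysis.Analysis"
begin

section \<open>Block vectors and matrices\<close>

text \<open>Stacked objects are indexed by sum types; the left summand is the upper or left block.
  \<open>vcat\<close> stacks vectors as well as matrices, since a matrix is a vector of rows.\<close>

definition vcat :: "'x ^ 'a \<Rightarrow> 'x ^ 'b \<Rightarrow> 'x ^ ('a::finite + 'b::finite)" where
  "vcat u v = (\<chi> i. case i of Inl a \<Rightarrow> u $ a | Inr b \<Rightarrow> v $ b)"

definition hcat :: "'x ^ 'a ^ 'r \<Rightarrow> 'x ^ 'b ^ 'r \<Rightarrow> 'x ^ ('a::finite + 'b::finite) ^ 'r::finite" where
  "hcat M N = (\<chi> i. vcat (M $ i) (N $ i))"

definition block ::
  "'x ^ 'c ^ 'a \<Rightarrow> 'x ^ 'd ^ 'a \<Rightarrow> 'x ^ 'c ^ 'b \<Rightarrow> 'x ^ 'd ^ 'b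
    \<Rightarrow> 'x ^ ('c::finite + 'd::finite) ^ ('a::finite + 'b::finite)" where
  "block M11 M12 M21 M22 = vcat (hcat M11 M12) (hcat M21 M22)"

definition symmetric_mat :: "real ^ 'n ^ 'n \<Rightarrow> bool" where
  "symmetric_mat M \<longleftrightarrow> transpose M = M"

definition pos_def :: "real ^ 'n ^ 'n \<Rightarrow> bool" where
  "pos_def M \<longleftrightarrow> symmetric_mat M \<and> (\<forall>x. x \<noteq> 0 \<longrightarrow> x \<bullet> (M *v x) > 0)"

definition pos_semidef :: "real ^ 'n ^ 'n \<Rightarrow> bool" where
  "pos_semidef M \<longleftrightarrow> symmetric_mat M \<and> (\<forall>x. x \<bullet> (M *v x) \<ge> 0)"

definition neg_def :: "real ^ 'n ^ 'n \<Rightarrow> bool" where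
  "neg_def M \<longleftrightarrow> symmetric_mat M \<and> (\<forall>x. x \<noteq> 0 \<longrightarrow> x \<bullet> (M *v x) < 0)"

section \<open>Signals and trajectories\<close>

text \<open>A function on \<open>[0,\<infinity>)\<close> is represented by its unique extensional extension to the
  real line. Piecewise continuity means finitely many discontinuities in every bounded interval,
  with finite one-sided limits; the limits from the right are covered by right-continuity.\<close>

definition signals :: "(real \<Rightarrow> real ^ 'n) set" where
  "signals = {u \<in> extensional {0..}.
     (\<forall>T\<ge>0. finite {t \<in> {0..T}. \<not> continuous (at t within {0..}) u}) \<and>
     (\<forall>t>0. \<exists>l. (u \<longlongrightarrow> l) (at_left t)) \<and>
     (\<forall>t\<ge>0. (u \<longlongrightarrow> u t) (at_right t))}"

definition state_trajectory :: "(real \<Rightarrow> real ^ 'n) \<Rightarrow> (real \<Rightarrow> real ^ 'n) \<Rightarrow> bool" where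
  "state_trajectory x x' \<longleftrightarrow>
     x \<in> extensional {0..} \<and> continuous_on {0..} x \<and> x' \<in> signals \<and>
     (\<forall>t\<ge>0. (x has_vector_derivative x' t) (at t within {t..}))"

definition uncertainty ::
  "((real \<Rightarrow> real ^ 'k) \<Rightarrow> (real \<Rightarrow> real ^ 'm) set) \<Rightarrow> bool" where
  "uncertainty \<Delta> \<longleftrightarrow> (\<forall>z\<in>signals. \<Delta> z \<subseteq> signals)"

section \<open>Integral quadratic constraints with terminal cost\<close>

definition filter_response ::
  "real ^ 's ^ 's \<Rightarrow> real ^ 'k ^ 's \<Rightarrow> real ^ 'm ^ 's
    \<Rightarrow> real ^ 's ^ 'p \<Rightarrow> real ^ 'k ^ 'p \<Rightarrow> real ^ 'm ^ 'p
    \<Rightarrow> (real \<Rightarrow> real ^ 'k) \<Rightarrow> (real \<Rightarrow> real ^ 'm) \<Rightarrow> (real \<Rightarrow> real ^ 's) \<Rightarrow> (real \<Rightarrow> real ^ 'p) \<Rightarrow> bool"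
where
  "filter_response A\<Psi> B\<Psi>1 B\<Psi>2 C\<Psi> D\<Psi>1 D\<Psi>2 z w \<xi> v \<longleftrightarrow>
     (\<exists>\<xi>'. state_trajectory \<xi> \<xi>' \<and>
       (\<forall>t\<ge>0. \<xi>' t = A\<Psi> *v \<xi> t + B\<Psi>1 *v z t + B\<Psi>2 *v w t)) \<and>
     \<xi> 0 = 0 \<and>
     v \<in> signals \<and>
     (\<forall>t\<ge>0. v t = C\<Psi> *v \<xi> t + D\<Psi>1 *v z t + D\<Psi>2 *v w t)"

definition terminal_cost ::
  "real ^ 's ^ 's \<Rightarrow> real ^ 'k ^ 's \<Rightarrow> real ^ 'm ^ 's
    \<Rightarrow> real ^ 's ^ 'p \<Rightarrow> real ^ 'k ^ 'p \<Rightarrow> real ^ 'm ^ 'p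
    \<Rightarrow> ((real \<Rightarrow> real ^ 'k) \<Rightarrow> (real \<Rightarrow> real ^ 'm) set)
    \<Rightarrow> real ^ 'p ^ 'p \<Rightarrow> real ^ 's ^ 's \<Rightarrow> bool"
where
  "terminal_cost A\<Psi> B\<Psi>1 B\<Psi>2 C\<Psi> D\<Psi>1 D\<Psi>2 \<Delta> P Z \<longleftrightarrow>
     symmetric_mat Z \<and>
     (\<forall>w\<in>signals. \<forall>z\<in>signals. w \<in> \<Delta> z \<longrightarrow>
       (\<forall>\<xi> v. filter_response A\<Psi> B\<Psi>1 B\<Psi>2 C\<Psi> D\<Psi>1 D\<Psi>2 z w \<xi> v \<longrightarrow>
         (\<forall>T\<ge>0. integral {0..T} (\<lambda>t. v t \<bullet> (P *v v t)) - \<xi> T \<bullet> (Z *v \<xi> T) \<ge> 0)))"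

definition iqc_terminal_cost ::
  "real ^ 's ^ 's \<Rightarrow> real ^ 'k ^ 's \<Rightarrow> real ^ 'm ^ 's
    \<Rightarrow> real ^ 's ^ 'p \<Rightarrow> real ^ 'k ^ 'p \<Rightarrow> real ^ 'm ^ 'p
    \<Rightarrow> ((real \<Rightarrow> real ^ 'k) \<Rightarrow> (real \<Rightarrow> real ^ 'm) set) \<Rightarrow> (real ^ 'p ^ 'p) set \<Rightarrow> bool"
where
  "iqc_terminal_cost A\<Psi> B\<Psi>1 B\<Psi>2 C\<Psi> D\<Psi>1 D\<Psi>2 \<Delta> PP \<longleftrightarrow>
     (\<forall>P\<in>PP. \<exists>Z. terminal_cost A\<Psi> B\<Psi>1 B\<Psi>2 C\<Psi> D\<Psi>1 D\<Psi>2 \<Delta> P Z)"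

section \<open>Uncertain interconnections\<close>

definition interconnection ::
  "real ^ 'n ^ 'n \<Rightarrow> real ^ 'm ^ 'n \<Rightarrow> real ^ 'd ^ 'n
    \<Rightarrow> real ^ 'n ^ 'k \<Rightarrow> real ^ 'm ^ 'k \<Rightarrow> real ^ 'd ^ 'k
    \<Rightarrow> real ^ 'n ^ 'e \<Rightarrow> real ^ 'm ^ 'e \<Rightarrow> real ^ 'd ^ 'e
    \<Rightarrow> ((real \<Rightarrow> real ^ 'k) \<Rightarrow> (real \<Rightarrow> real ^ 'm) set)
    \<Rightarrow> (real \<Rightarrow> real ^ 'n) \<Rightarrow> (real \<Rightarrow> real ^ 'm) \<Rightarrow> (real \<Rightarrow> real ^ 'd)
    \<Rightarrow> (real \<Rightarrow> real ^ 'k) \<Rightarrow> (real \<Rightarrow> real ^ 'e) \<Rightarrow> bool"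
where
  "interconnection A B Bd C D Dd Ce De Ded \<Delta> x w d z e \<longleftrightarrow>
     w \<in> signals \<and> d \<in> signals \<and> z \<in> signals \<and> e \<in> signals \<and>
     (\<exists>x'. state_trajectory x x' \<and> (\<forall>t\<ge>0. x' t = A *v x t + B *v w t + Bd *v d t)) \<and>
     (\<forall>t\<ge>0. z t = C *v x t + D *v w t + Dd *v d t) \<and>
     (\<forall>t\<ge>0. e t = Ce *v x t + De *v w t + Ded *v d t) \<and>
     w \<in> \<Delta> z"

definition loop ::
  "real ^ 'n ^ 'n \<Rightarrow> real ^ 'm ^ 'n \<Rightarrow> real ^ 'n ^ 'k \<Rightarrow> real ^ 'm ^ 'k
    \<Rightarrow> ((real \<Rightarrow> real ^ 'k) \<Rightarrow> (real \<Rightarrow> real ^ 'm) set)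
    \<Rightarrow> (real \<Rightarrow> real ^ 'n) \<Rightarrow> (real \<Rightarrow> real ^ 'm) \<Rightarrow> (real \<Rightarrow> real ^ 'k) \<Rightarrow> bool"
where
  "loop A B C D \<Delta> x w z \<longleftrightarrow>
     w \<in> signals \<and> z \<in> signals \<and>
     (\<exists>x'. state_trajectory x x' \<and> (\<forall>t\<ge>0. x' t = A *v x t + B *v w t)) \<and>
     (\<forall>t\<ge>0. z t = C *v x t + D *v w t) \<and>
     w \<in> \<Delta> z"

definition robust_quadratic_performance ::
  "real ^ 'n ^ 'n \<Rightarrow> real ^ 'm ^ 'n \<Rightarrow> real ^ 'd ^ 'n
    \<Rightarrow> real ^ 'n ^ 'k \<Rightarrow> real ^ 'm ^ 'k \<Rightarrow> real ^ 'd ^ 'k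
    \<Rightarrow> real ^ 'n ^ 'e \<Rightarrow> real ^ 'm ^ 'e \<Rightarrow> real ^ 'd ^ 'e
    \<Rightarrow> ((real \<Rightarrow> real ^ 'k) \<Rightarrow> (real \<Rightarrow> real ^ 'm) set)
    \<Rightarrow> real ^ ('e + 'd) ^ ('e + 'd) \<Rightarrow> bool"
where
  "robust_quadratic_performance A B Bd C D Dd Ce De Ded \<Delta> Pp \<longleftrightarrow>
     (\<exists>\<gamma>p>0. \<forall>x w d z e. interconnection A B Bd C D Dd Ce De Ded \<Delta> x w d z e \<longrightarrow>
       (\<forall>T\<ge>0. integral {0..T} (\<lambda>t. vcat (e t) (d t) \<bullet> (Pp *v vcat (e t) (d t)))
               \<le> \<gamma>p * (norm (x 0))\<^sup>2))"

definition robustly_stable ::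
  "real ^ 'n ^ 'n \<Rightarrow> real ^ 'm ^ 'n \<Rightarrow> real ^ 'n ^ 'k \<Rightarrow> real ^ 'm ^ 'k
    \<Rightarrow> ((real \<Rightarrow> real ^ 'k) \<Rightarrow> (real \<Rightarrow> real ^ 'm) set) \<Rightarrow> bool"
where
  "robustly_stable A B C D \<Delta> \<longleftrightarrow>
     (\<exists>\<gamma>>0. \<forall>x0 x w z. loop A B C D \<Delta> x w z \<and> x 0 = x0 \<longrightarrow>
       (\<forall>T\<ge>0. integral {0..T} (\<lambda>t. (norm (x t))\<^sup>2) + integral {0..T} (\<lambda>t. (norm (w t))\<^sup>2)
               \<le> \<gamma>\<^sup>2 * (norm x0)\<^sup>2))"

lemma signals_add:
  fixes u v :: "real \<Rightarrow> real ^ 'n"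
  assumes u: "u \<in> signals" and v: "v \<in> signals"
  shows "(\<lambda>t\<in>{0..}. u t + v t) \<in> signals"
proof -
  let ?s = "\<lambda>t\<in>{0..}. u t + v t"
  have cont: "continuous (at t within {0..}) ?s"
    if "t \<ge> 0" "continuous (at t within {0..}) u" "continuous (at t within {0..}) v" for t
  proof -
    have "continuous (at t within {0..}) (\<lambda>t. u t + v t)"
      using that by (intro continuous_intros)
    then show ?thesis
      using that(1) by (auto intro: continuous_transform_within[OF _ zero_less_one])
  qed
  have fin: "finite {t \<in> {0..T}. \<not> continuous (at t within {0..}) ?s}" if "T \<ge> 0" for T
  proof (rule finite_subset)
    show "{t \<in> {0..T}. \<not> continuous (at t within {0..}) ?s} \<subseteq>
      {t \<in> {0..T}. \<not> continuous (at t within {0..}) u} \<union>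
      {t \<in> {0..T}. \<not> continuous (at t within {0..}) v}"
      using cont by auto
    show "finite ({t \<in> {0..T}. \<not> continuous (at t within {0..}) u} \<union>
      {t \<in> {0..T}. \<not> continuous (at t within {0..}) v})"
      using u v that by (simp add: signals_def)
  qed
  have left: "\<exists>l. (?s \<longlongrightarrow> l) (at_left t)" if t: "t > 0" for t
  proof -
    obtain l1 l2 where "(u \<longlongrightarrow> l1) (at_left t)" "(v \<longlongrightarrow> l2) (at_left t)"
      using u v t unfolding signals_def by blast
    then have "((\<lambda>t. u t + v t) \<longlongrightarrow> l1 + l2) (at_left t)"
      by (rule tendsto_add)
    moreover have "\<forall>\<^sub>F r in at_left t. u r + v r = ?s r"
      using eventually_at_left_real[OF t] by eventually_elim simp
    ultimately show ?thesis
      using Lim_transform_eventually by blast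
  qed
  have right: "(?s \<longlongrightarrow> ?s t) (at_right t)" if t: "t \<ge> 0" for t
  proof -
    have "((\<lambda>t. u t + v t) \<longlongrightarrow> u t + v t) (at_right t)"
      using u v t by (intro tendsto_add) (auto simp: signals_def)
    moreover have "\<forall>\<^sub>F r in at_right t. u r + v r = ?s r"
      using eventually_at_right_less[of t] by eventually_elim (use t in simp)
    ultimately show ?thesis
      using t Lim_transform_eventually by fastforce
  qed
  show ?thesis
    unfolding signals_def using fin left right by blast
qed

lemma signals_mult:
  fixes u :: "real \<Rightarrow> real ^ 'n" and M :: "real ^ 'n ^ 'm"
  assumes u: "u \<in> signals"
  shows "(\<lambda>t\<in>{0..}. M *v u t) \<in> signals"
proof -
  let ?s = "\<lambda>t\<in>{0..}. M *v u t"
  have bl: "bounded_linear ((*v) M)"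
    by (rule matrix_vector_mul_bounded_linear)
  have cont: "continuous (at t within {0..}) ?s"
    if "t \<ge> 0" "continuous (at t within {0..}) u" for t
  proof -
    have "continuous (at t within {0..}) (\<lambda>t. M *v u t)"
      using that bounded_linear.continuous[OF bl] by blast
    then show ?thesis
      using that(1) by (auto intro: continuous_transform_within[OF _ zero_less_one])
  qed
  have fin: "finite {t \<in> {0..T}. \<not> continuous (at t within {0..}) ?s}" if "T \<ge> 0" for T
  proof (rule finite_subset)
    show "{t \<in> {0..T}. \<not> continuous (at t within {0..}) ?s} \<subseteq>
      {t \<in> {0..T}. \<not> continuous (at t within {0..}) u}"
      using cont by auto
    show "finite {t \<in> {0..T}. \<not> continuous (at t within {0..}) u}"
      using u that by (simp add: signals_def)
  qed
  have left: "\<exists>l. (?s \<longlongrightarrow> l) (at_left t)" if t: "t > 0" for t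
  proof -
    obtain l where "(u \<longlongrightarrow> l) (at_left t)"
      using u t unfolding signals_def by blast
    then have "((\<lambda>t. M *v u t) \<longlongrightarrow> M *v l) (at_left t)"
      by (rule bounded_linear.tendsto[OF bl])
    moreover have "\<forall>\<^sub>F r in at_left t. M *v u r = ?s r"
      using eventually_at_left_real[OF t] by eventually_elim simp
    ultimately show ?thesis
      using Lim_transform_eventually by blast
  qed
  have right: "(?s \<longlongrightarrow> ?s t) (at_right t)" if t: "t \<ge> 0" for t
  proof -
    have "((\<lambda>t. M *v u t) \<longlongrightarrow> M *v u t) (at_right t)"
      using u t by (intro bounded_linear.tendsto[OF bl]) (auto simp: signals_def)
    moreover have "\<forall>\<^sub>F r in at_right t. M *v u r = ?s r"
      using eventually_at_right_less[of t] by eventually_elim (use t in simp)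
    ultimately show ?thesis
      using t Lim_transform_eventually by fastforce
  qed
  show ?thesis
    unfolding signals_def using fin left right by blast
qed

lemma signals_continuous:
  fixes x :: "real \<Rightarrow> real ^ 'n"
  assumes ext: "x \<in> extensional {0..}" and x: "continuous_on {0..} x"
  shows "x \<in> signals"
proof -
  have c: "(x \<longlongrightarrow> x t) (at t within {0..})" if "t \<ge> 0" for t
    using x that by (simp add: continuous_on_def)
  have none: "{t \<in> {0..T}. \<not> continuous (at t within {0..}) x} = {}" for T
    using x by (auto simp: continuous_on_eq_continuous_within)
  have left: "(x \<longlongrightarrow> x t) (at_left t)" if t: "t > 0" for t
  proof -
    have "isCont x t"
      using x t by (simp add: continuous_on_interior)
    then show ?thesis
      by (simp add: continuous_at filterlim_at_split)
  qed
  have right: "(x \<longlongrightarrow> x t) (at_right t)" if "t \<ge> 0" for t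
    by (rule tendsto_within_subset[OF c[OF that]]) (use that in auto)
  show ?thesis
    unfolding signals_def mem_Collect_eq none using ext left right by blast
qed

lemma loop_iff_interconnection:
  fixes A :: "real ^ 'n ^ 'n" and Bd :: "real ^ 'd ^ 'n" and Dd :: "real ^ 'd ^ 'k"
    and Ce :: "real ^ 'n ^ 'e" and De :: "real ^ 'm ^ 'e" and Ded :: "real ^ 'd ^ 'e"
  shows "loop A B C D \<Delta> x w z \<longleftrightarrow>
    (\<exists>e. interconnection A B Bd C D Dd Ce De Ded \<Delta> x w (\<lambda>t\<in>{0..}. 0) z e)"
proof
  assume l: "loop A B C D \<Delta> x w z"
  let ?e = "\<lambda>t\<in>{0..}. (\<lambda>t\<in>{0..}. Ce *v x t) t + (\<lambda>t\<in>{0..}. De *v w t) t"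
  have x: "x \<in> signals" and w: "w \<in> signals"
    using l by (auto simp: loop_def state_trajectory_def intro: signals_continuous)
  have e: "?e \<in> signals"
    by (intro signals_add signals_mult x w)
  have d: "(\<lambda>t\<in>{0..}. 0 :: real ^ 'd) \<in> signals"
    using signals_mult[OF x, of "0 :: real ^ 'n ^ 'd"] by simp
  have "interconnection A B Bd C D Dd Ce De Ded \<Delta> x w (\<lambda>t\<in>{0..}. 0) z ?e"
    using l e d by (auto simp: loop_def interconnection_def)
  then show "\<exists>e. interconnection A B Bd C D Dd Ce De Ded \<Delta> x w (\<lambda>t\<in>{0..}. 0) z e"
    by blast
next
  assume "\<exists>e. interconnection A B Bd C D Dd Ce De Ded \<Delta> x w (\<lambda>t\<in>{0..}. 0) z e"
  then show "loop A B C D \<Delta> x w z"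
    by (auto simp: loop_def interconnection_def)
qed

end

theory Submission
  imports Defs
begin

text \<open>The proof is a dissipation argument. Along a trajectory, feed \<open>z\<close> and \<open>w\<close> into the filter
  to obtain the state \<open>\<xi>\<close> and the output \<open>v\<close>, and take the storage function
  \<open>\<eta>\<^sup>T X \<eta>\<close> of the combined state \<open>\<eta> = (\<xi>, x)\<close>. Multiplying the matrix inequality from both sides with
  \<open>(\<eta>, w, d)\<close> says that the derivative of the storage plus the supply \<open>v\<^sup>T P v\<close>, the performance
  density and \<open>\<epsilon> (\<bar>x\<bar>\<^sup>2 + \<bar>w\<bar>\<^sup>2)\<close> is at most zero; the margin \<open>\<epsilon>\<close> comes from strictness and
  compactness of the unit sphere (\<open>lmi_imp_storage_dissipates\<close>). Integration over \<open>[0, T]\<close> and the IQC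
  \<open>\<integral> v\<^sup>T P v \<ge> \<xi>(T)\<^sup>T Z \<xi>(T)\<close> move the terminal cost into the storage at time \<open>T\<close>
  (\<open>interconnection_dissipation\<close>). The filter starts at zero, so the initial storage is \<open>x(0)\<^sup>T X\<^sub>2 x(0)\<close>.
  At time \<open>T\<close> storage and terminal cost together form the quadratic form of the positive definite coupling
  matrix; minimizing it over the unknown filter state \<open>\<xi>(T)\<close> leaves the Schur complement \<open>E(X, Z)\<close>
  (\<open>schur_complement_le\<close>). This is the main estimate. Performance follows by discarding nonnegative
  terms, and stability by setting \<open>d = 0\<close>, where the performance density reduces to \<open>e\<^sup>T Q\<^sub>p e \<ge> 0\<close>.

  Two points of analysis lie below this argument. Signals may jump, so storage functions only have a right
  derivative; a continuous function whose right derivative is nowhere positive still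
  cannot increase
  (\<open>right_derivative_nonpos_imp_le\<close>), which makes it possible to integrate the inequality without
  a fundamental theorem for one-sided derivatives. Moreover, the IQC only speaks about filter responses that
  exist. Their existence on the whole half line for every admissible input is \<open>filter_response_exists\<close>;
  it rests on the Picard series of a linear integral equation.\<close>

section \<open>Piecewise continuous functions\<close>

text \<open>The conditions in \<open>signals\<close>, apart from extensionality, for values in an arbitrary space. They
  are then preserved by pairing and by continuous maps, so that they reach the scalar
  integrands.\<close>

definition piecewise_rcont :: "(real \<Rightarrow> 'a::topological_space) \<Rightarrow> bool" where
  "piecewise_rcont f \<longleftrightarrow>
     (\<forall>T\<ge>0. finite {t \<in> {0..T}. \<not> continuous (at t within {0..}) f}) \<and>
     (\<forall>t>0. \<exists>l. (f \<longlongrightarrow> l) (at_left t)) \<and>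
     (\<forall>t\<ge>0. (f \<longlongrightarrow> f t) (at_right t))"

lemma signals_imp_piecewise_rcont: "u \<in> signals \<Longrightarrow> piecewise_rcont u"
  by (simp add: signals_def piecewise_rcont_def)

lemma state_trajectory_imp_piecewise_rcont: "state_trajectory x x' \<Longrightarrow> piecewise_rcont x"
  by (simp add: state_trajectory_def signals_continuous signals_imp_piecewise_rcont)

lemma piecewise_rcont_Pair:
  assumes f: "piecewise_rcont f" and g: "piecewise_rcont g"
  shows "piecewise_rcont (\<lambda>t. (f t, g t))"
proof -
  let ?D = "\<lambda>h T. {t \<in> {0..T}. \<not> continuous (at t within {0..}) h}"
  have "finite (?D (\<lambda>t. (f t, g t)) T)" if "T \<ge> 0" for T
  proof (rule finite_subset)
    show "?D (\<lambda>t. (f t, g t)) T \<subseteq> ?D f T \<union> ?D g T"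
      by (auto intro: continuous_Pair)
    show "finite (?D f T \<union> ?D g T)"
      using f g that unfolding piecewise_rcont_def by blast
  qed
  moreover have "\<exists>l. ((\<lambda>t. (f t, g t)) \<longlongrightarrow> l) (at_left t)" if "t > 0" for t
  proof -
    obtain k l where "(f \<longlongrightarrow> k) (at_left t)" "(g \<longlongrightarrow> l) (at_left t)"
      using f g \<open>t > 0\<close> unfolding piecewise_rcont_def by blast
    then show ?thesis
      using tendsto_Pair by blast
  qed
  ultimately show ?thesis
    using f g unfolding piecewise_rcont_def by (blast intro: tendsto_Pair)
qed

lemma piecewise_rcont_compose:
  assumes f: "piecewise_rcont f" and \<phi>: "continuous_on UNIV \<phi>"
  shows "piecewise_rcont (\<lambda>t. \<phi> (f t))"
proof -
  let ?D = "\<lambda>h T. {t \<in> {0..T}. \<not> continuous (at t within {0..}) h}"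
  have lim: "((\<lambda>t. \<phi> (f t)) \<longlongrightarrow> \<phi> l) F" if "(f \<longlongrightarrow> l) F" for l F
    using \<phi> that continuous_on_tendsto_compose by fastforce
  have "finite (?D (\<lambda>t. \<phi> (f t)) T)" if "T \<ge> 0" for T
  proof (rule finite_subset)
    show "?D (\<lambda>t. \<phi> (f t)) T \<subseteq> ?D f T"
      by (auto simp: continuous_within intro: lim)
    show "finite (?D f T)"
      using f that unfolding piecewise_rcont_def by blast
  qed
  then show ?thesis
    using f lim unfolding piecewise_rcont_def by meson
qed

lemma piecewise_rcont_add:
  fixes f g :: "real \<Rightarrow> 'a::real_normed_vector"
  assumes "piecewise_rcont f" and "piecewise_rcont g"
  shows "piecewise_rcont (\<lambda>t. f t + g t)"
  using piecewise_rcont_compose[OF piecewise_rcont_Pair[OF assms], of "\<lambda>p. fst p + snd p"]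
  by (simp add: continuous_intros)

text \<open>Integrability is a local property. Discontinuities are isolated, so around any point \<open>x\<close> the
  function is continuous on a small interval to the right of \<open>x\<close>, and to the left of \<open>x\<close> it becomes
  continuous once its value at \<open>x\<close> is replaced by the left limit.\<close>

lemma piecewise_rcont_integrable:
  fixes f :: "real \<Rightarrow> 'a::banach"
  assumes f: "piecewise_rcont f" and a: "0 \<le> a"
  shows "f integrable_on {a..b}"
proof -
  let ?D = "{t \<in> {0..\<bar>b\<bar>}. \<not> continuous (at t within {0..}) f}"
  have fin: "finite ?D"
    using f by (simp add: piecewise_rcont_def)
  have local: "\<exists>d>0. \<forall>u v. x \<in> {u..v} \<and> {u..v} \<subseteq> ball x d \<and> {u..v} \<subseteq> {a..b} \<longrightarrow> f integrable_on {u..v}"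
    if x: "x \<in> {a..b}" for x
  proof -
    obtain d where d: "d > 0" "\<And>t. t \<in> ?D \<Longrightarrow> t \<noteq> x \<Longrightarrow> d \<le> dist x t"
      using finite_set_avoid[OF fin, of x] by blast
    have cont: "continuous (at t within {0..}) f" if "t \<in> {a..b}" "dist x t < d" "t \<noteq> x" for t
      using d(2)[of t] that a by force
    have "f integrable_on {u..v}"
      if uv: "x \<in> {u..v}" "{u..v} \<subseteq> ball x d" "{u..v} \<subseteq> {a..b}" for u v
    proof -
      have uv0: "0 \<le> u" "u \<le> x" "x \<le> v"
        using uv a by auto
      have near: "dist x t < d" if "t \<in> {u..v}" for t
        using uv(2) that by (auto simp: subset_eq)
      have right: "f integrable_on {x..v}"
      proof (rule integrable_continuous_real)
        show "continuous_on {x..v} f"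
          unfolding continuous_on_eq_continuous_within
        proof
          fix t assume t: "t \<in> {x..v}"
          show "continuous (at t within {x..v}) f"
          proof (cases "t = x")
            case True
            have "(f \<longlongrightarrow> f x) (at x within {x<..})"
              using f a x by (simp add: piecewise_rcont_def)
            then have "(f \<longlongrightarrow> f x) (at x within {x..})"
              by (simp add: at_within_Ici_at_right)
            then show ?thesis
              using True tendsto_within_subset[of f _ x "{x..}" "{x..v}"]
              by (auto simp: continuous_within)
          next
            case False
            then have "continuous (at t within {0..}) f"
              using t uv uv0 by (intro cont near) auto
            then show ?thesis
              using uv0 by (rule_tac continuous_within_subset) auto
          qed
        qed
      qed
      have left: "f integrable_on {u..x}"
      proof (cases "u < x")
        case False
        then show ?thesis using uv0 integrable_on_refl[of f x] by simp
      next
        case True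
        then obtain l where l: "(f \<longlongrightarrow> l) (at_left x)"
          using f uv0 unfolding piecewise_rcont_def by fastforce
        let ?g = "f(x := l)"
        have "continuous_on {u..x} ?g"
          unfolding continuous_on_eq_continuous_within
        proof
          fix t assume t: "t \<in> {u..x}"
          show "continuous (at t within {u..x}) ?g"
          proof (cases "t = x")
            case True
            have "(?g \<longlongrightarrow> l) (at_left x)"
              using l by (rule Lim_transform_within[OF _ zero_less_one]) auto
            then have "(?g \<longlongrightarrow> l) (at x within {u..x})"
              using \<open>u < x\<close> by (simp add: at_within_Icc_at_left)
            then show ?thesis
              using True by (simp add: continuous_within)
          next
            case False
            then have "continuous (at t within {0..}) f"
              using t uv uv0 by (intro cont near) auto
            then have "continuous (at t within {u..x}) f"
              using uv0 by (rule_tac continuous_within_subset) auto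
            then show ?thesis
              using False t
              by (elim continuous_transform_within[where \<delta> = "dist t x"]) (auto simp: dist_commute)
          qed
        qed
        then have "?g integrable_on {u..x}"
          by (rule integrable_continuous_real)
        then show ?thesis
          by (rule integrable_spike_finite[of "{x}", rotated 2]) auto
      qed
      show ?thesis
        using left right uv0 by (intro Henstock_Kurzweil_Integration.integrable_combine[of u x v]) auto
    qed
    then show ?thesis using d(1) by blast
  qed
  show ?thesis
    using integrable_on_little_subintervals[of a b f] local by simp
qed

lemma piecewise_rcont_integral_right_derivative:
  fixes f :: "real \<Rightarrow> 'a::banach"
  assumes f: "piecewise_rcont f" and t: "0 \<le> t"
  shows "((\<lambda>T. integral {0..T} f) has_vector_derivative f t) (at t within {t..})"
proof -
  have int: "f integrable_on {a..b}" if "0 \<le> a" for a b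
    using f that by (rule piecewise_rcont_integrable)
  have "(f \<longlongrightarrow> f t) (at_right t)"
    using f t by (simp add: piecewise_rcont_def)
  then have "continuous (at t within {t..t+1}) f"
    by (simp add: continuous_within at_within_Icc_at_right)
  then have "((\<lambda>T. integral {t..T} f) has_vector_derivative f t) (at t within {t..t+1})"
    using integral_has_vector_derivative_continuous_at[of f t "t+1" t "{}"] int[of t "t+1"] t
    by simp
  then have "((\<lambda>T. integral {t..T} f) has_vector_derivative f t) (at t within {t..})"
    by (simp add: has_vector_derivative_def has_derivative_within at_within_Icc_at_right at_within_Ici_at_right)
  then have "((\<lambda>T. integral {0..t} f + integral {t..T} f) has_vector_derivative f t) (at t within {t..})"
    using has_vector_derivative_add[OF has_vector_derivative_const] by fastforce
  then show ?thesis
    by (rule has_vector_derivative_transform[rotated 2])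
       (use t int in \<open>auto simp: Henstock_Kurzweil_Integration.integral_combine\<close>)
qed

lemma continuous_on_atLeast_zeroI:
  fixes f :: "real \<Rightarrow> 'a::topological_space"
  assumes "\<And>T. continuous_on {0..T} f"
  shows "continuous_on {0..} f"
  unfolding continuous_on_def
proof
  fix t :: real assume t: "t \<in> {0..}"
  have "(f \<longlongrightarrow> f t) (at t within {0..t+1})"
    using assms[of "t+1"] t by (simp add: continuous_on_def)
  moreover have "at t within {0..t+1} = at t within {0..}"
    using t by (intro at_within_nhd[of _ "{..<t+1}"]) auto
  ultimately show "(f \<longlongrightarrow> f t) (at t within {0..})"
    by simp
qed

lemma continuous_on_integral_upper_limit:
  fixes f :: "real \<Rightarrow> 'a::banach"
  assumes f: "\<And>T. f integrable_on {0..T}"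
  shows "continuous_on {0..} (\<lambda>T. integral {0..T} f)"
  by (intro continuous_on_atLeast_zeroI indefinite_integral_continuous_1 f)

section \<open>Monotonicity from right derivatives\<close>

text \<open>After subtracting \<open>\<epsilon> t\<close> the right derivative is strictly negative. If the resulting function
  \<open>h\<close> ended above its initial value, then at the last time \<open>c\<close> with \<open>h c \<le> h a\<close> it would still
  decrease to the right of \<open>c\<close>, which contradicts the choice of \<open>c\<close>.\<close>

lemma right_derivative_nonpos_imp_le:
  fixes g g' :: "real \<Rightarrow> real"
  assumes g: "continuous_on {a..b} g" and ab: "a \<le> b"
    and d: "\<And>t. a \<le> t \<Longrightarrow> t < b \<Longrightarrow> (g has_vector_derivative g' t) (at t within {t..})"
    and neg: "\<And>t. a \<le> t \<Longrightarrow> t < b \<Longrightarrow> g' t \<le> 0"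
  shows "g b \<le> g a"
proof -
  have approx: "g b - \<epsilon> * b \<le> g a - \<epsilon> * a" if \<epsilon>: "\<epsilon> > 0" for \<epsilon>
  proof (rule ccontr)
    define h where "h t = g t - \<epsilon> * t" for t
    assume "\<not> ?thesis"
    then have hb: "h b > h a" by (simp add: h_def)
    define S where "S = {t \<in> {a..b}. h t \<le> h a}"
    have hc: "continuous_on {a..b} h"
      unfolding h_def using g by (intro continuous_intros)
    have "S = {a..b} \<inter> h -` {..h a}"
      by (auto simp: S_def)
    then have "compact S"
      using hc by (simp add: compact_eq_bounded_closed continuous_closed_preimage bounded_Int)
    moreover have "a \<in> S" using ab by (simp add: S_def)
    ultimately obtain c where c: "c \<in> S" "\<And>t. t \<in> S \<Longrightarrow> t \<le> c"
      using compact_attains_sup[of S] by blast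
    have "c \<noteq> b" using c hb by (auto simp: S_def)
    then have cb: "a \<le> c" "c < b" "h c \<le> h a" using c by (auto simp: S_def)
    have "(h has_vector_derivative g' c - \<epsilon>) (at c within {c..})"
      unfolding h_def using d[OF cb(1,2)] by (auto intro!: derivative_eq_intros)
    then have "(h has_real_derivative g' c - \<epsilon>) (at c within {c..})"
      by (simp add: has_real_derivative_iff_has_vector_derivative)
    moreover have "g' c - \<epsilon> < 0" using neg[OF cb(1,2)] \<epsilon> by simp
    ultimately obtain r where r: "r > 0" "\<And>s. s > 0 \<Longrightarrow> c + s \<in> {c..} \<Longrightarrow> s < r \<Longrightarrow> h (c + s) < h c"
      using has_real_derivative_neg_dec_right by metis
    \<comment> \<open>Half of \<open>r\<close> stays inside the open range of decrease; \<open>b - c\<close> keeps \<open>c + s\<close> in the interval.\<close>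
    define s where "s = min (r/2) (b - c)"
    have "s > 0" "s < r" "c + s \<le> b" using r cb by (auto simp: s_def)
    then have "c + s \<in> S" using r(2)[of s] cb by (auto simp: S_def)
    then show False using c(2)[of "c+s"] \<open>s > 0\<close> by simp
  qed
  have "g b \<le> g a + \<epsilon>" if \<epsilon>: "\<epsilon> > 0" for \<epsilon>
  proof -
    \<comment> \<open>The summand 1 avoids division by zero when \<open>a = b\<close>.\<close>
    have "\<epsilon> / (b - a + 1) * (b - a) \<le> \<epsilon>"
      using ab \<epsilon> by (simp add: field_simps)
    moreover have "g b - g a \<le> \<epsilon> / (b - a + 1) * (b - a)"
      using approx[of "\<epsilon> / (b - a + 1)"] ab \<epsilon> by (simp add: right_diff_distrib)
    ultimately show ?thesis by linarith
  qed
  then show ?thesis by (rule field_le_epsilon)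
qed

section \<open>Existence of filter responses\<close>

text \<open>The solution is the sum of the Picard iterates of the integral operator applied to \<open>a\<close>. On
  \<open>[0, T]\<close> the \<open>n\<close>-th iterate is at most \<open>M (K t)\<^sup>n / n!\<close>, with \<open>M\<close> a bound of \<open>a\<close> there and \<open>K\<close> one of
  \<open>L\<close>. The exponential series dominates for every \<open>T\<close>, hence one series works on the whole half line
  and no local solutions have to be glued together.\<close>

lemma linear_volterra_solution:
  fixes a :: "real \<Rightarrow> 'a::banach" and L :: "'a \<Rightarrow> 'a"
  assumes L: "bounded_linear L" and a: "continuous_on {0..} a"
  obtains y where "continuous_on {0..} y"
    and "\<And>t. t \<ge> 0 \<Longrightarrow> y t = a t + integral {0..t} (\<lambda>s. L (y s))"
proof -
  obtain K where K: "K \<ge> 0" "\<And>x. norm (L x) \<le> norm x * K"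
    using bounded_linear.nonneg_bounded[OF L] by blast
  define Y where "Y = rec_nat a (\<lambda>_ g t. integral {0..t} (\<lambda>s. L (g s)))"
  have Y0: "Y 0 = a" and YS: "Y (Suc n) = (\<lambda>t. integral {0..t} (\<lambda>s. L (Y n s)))" for n
    by (simp_all add: Y_def)
  have contL: "continuous_on S (\<lambda>s. L (g s))" if "continuous_on S g" for S :: "real set" and g
    by (rule bounded_linear.continuous_on[OF L that])
  have cont: "continuous_on {0..} (Y n)" for n
  proof (induction n)
    case (Suc n)
    have "(\<lambda>s. L (Y n s)) integrable_on {0..T}" for T
      by (rule integrable_continuous_real, rule contL, rule continuous_on_subset[OF Suc]) auto
    then show ?case
      unfolding YS by (rule continuous_on_integral_upper_limit)
  qed (simp add: Y0 a)
  have cont': "continuous_on {0..T} (Y n)" for n T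
    by (rule continuous_on_subset[OF cont]) auto
  have unif: "uniform_limit {0..T} (\<lambda>n t. \<Sum>i<n. Y i t) (\<lambda>t. \<Sum>i. Y i t) sequentially" for T
  proof -
    have "bounded (a ` {0..T})"
      by (rule compact_imp_bounded, rule compact_continuous_image)
         (auto intro: continuous_on_subset[OF a])
    then obtain M where M: "M > 0" "\<And>t. t \<in> {0..T} \<Longrightarrow> norm (a t) \<le> M"
      unfolding bounded_pos by blast
    have bound: "norm (Y n t) \<le> M * (K * t) ^ n / fact n" if "t \<in> {0..T}" for n t
      using that
    proof (induction n arbitrary: t)
      case 0
      then show ?case by (simp add: Y0 M)
    next
      case (Suc n)
      have der: "((\<lambda>s. M * (K * s) ^ Suc n / fact (Suc n)) has_vector_derivative
          M * (K * s) ^ n / fact n * K) (at s within {0..t})"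
        for s and t :: real
      proof -
        define c where "c = M * K ^ Suc n / fact (Suc n)"
        have "((\<lambda>s. c * s ^ Suc n) has_real_derivative c * (real (Suc n) * s ^ (Suc n - Suc 0)))
            (at s within {0..t})"
          by (intro DERIV_cmult DERIV_pow)
        moreover have "c * (real (Suc n) * s ^ (Suc n - Suc 0)) = M * (K * s) ^ n / fact n * K"
          unfolding c_def fact_Suc by (simp add: power_mult_distrib del: of_nat_Suc)
        moreover have "(\<lambda>s. c * s ^ Suc n) = (\<lambda>s. M * (K * s) ^ Suc n / fact (Suc n))"
            unfolding c_def power_mult_distrib by (simp add: mult.assoc)
        ultimately show ?thesis
          by (simp only: has_real_derivative_iff_has_vector_derivative)
      qed
      have int: "((\<lambda>s. M * (K * s) ^ n / fact n * K) has_integral M * (K * t) ^ Suc n / fact (Suc n)) {0..t}"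
        using fundamental_theorem_of_calculus[OF _ der, of t] Suc.prems by simp
      have "norm (integral {0..t} (\<lambda>s. L (Y n s))) \<le> integral {0..t} (\<lambda>s. M * (K * s) ^ n / fact n * K)"
      proof (rule integral_norm_bound_integral)
        show "(\<lambda>s. L (Y n s)) integrable_on {0..t}"
          by (rule integrable_continuous_real, rule contL, rule cont')
        show "(\<lambda>s. M * (K * s) ^ n / fact n * K) integrable_on {0..t}"
          using int by blast
        show "norm (L (Y n s)) \<le> M * (K * s) ^ n / fact n * K" if "s \<in> {0..t}" for s
        proof -
          have "norm (Y n s) \<le> M * (K * s) ^ n / fact n"
            using that Suc.prems by (intro Suc.IH) auto
          then show ?thesis
            using K by (meson mult_right_mono order_trans)
        qed
      qed
      then show ?case
        by (simp only: YS integral_unique[OF int])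
    qed
    have "norm (Y n t) \<le> M * ((K * T) ^ n /\<^sub>R fact n)" if "t \<in> {0..T}" for n t
    proof -
      have "(K * t) ^ n \<le> (K * T) ^ n"
        using that K by (intro power_mono mult_left_mono) auto
      then have "M * (K * t) ^ n / fact n \<le> M * (K * T) ^ n / fact n"
        using M by (intro divide_right_mono mult_left_mono) auto
      then show ?thesis
        using bound[OF that, of n] by (simp add: field_simps)
    qed
    moreover have "summable (\<lambda>n. M * ((K * T) ^ n /\<^sub>R fact n))"
      by (intro summable_mult summable_exp_generic)
    ultimately show ?thesis
      by (intro Weierstrass_m_test)
  qed
  define y where "y t = (\<Sum>i. Y i t)" for t
  have unif: "uniform_limit {0..T} (\<lambda>n t. \<Sum>i<n. Y i t) y sequentially" for T
    using unif[of T] by (simp add: y_def [abs_def])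
  have contT: "continuous_on {0..T} y" for T
    by (rule uniform_limit_theorem[OF _ unif]) (auto intro!: always_eventually continuous_on_sum cont')
  have "continuous_on {0..} y"
    using contT by (rule continuous_on_atLeast_zeroI)
  moreover have "y t = a t + integral {0..t} (\<lambda>s. L (y s))" if t: "t \<ge> 0" for t
  proof -
    have "uniform_limit {0..t} (\<lambda>n s. L (\<Sum>i<n. Y i s)) (\<lambda>s. L (y s)) sequentially"
      by (rule bounded_linear.uniform_limit[OF L unif])
    then obtain I J where I: "\<And>n. ((\<lambda>s. L (\<Sum>i<n. Y i s)) has_integral I n) {0..t}"
      and J: "((\<lambda>s. L (y s)) has_integral J) {0..t}" and IJ: "I \<longlonglongrightarrow> J"
      by (rule uniform_limit_integral) (auto intro!: contL continuous_on_sum cont')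
    have "I n = (\<Sum>i<n. Y (Suc i) t)" for n
    proof -
      have "((\<lambda>s. \<Sum>i<n. L (Y i s)) has_integral (\<Sum>i<n. Y (Suc i) t)) {0..t}"
        unfolding YS
        by (intro has_integral_sum integrable_integral integrable_continuous_real contL cont') auto
      then have "((\<lambda>s. L (\<Sum>i<n. Y i s)) has_integral (\<Sum>i<n. Y (Suc i) t)) {0..t}"
        by (simp add: linear_sum[OF bounded_linear.linear[OF L]])
      then show ?thesis
        using I has_integral_unique by blast
    qed
    \<comment> \<open>Integrating a partial sum shifts the index, so the limit of the partial sums solves the equation.\<close>
    then have "(\<Sum>i<Suc n. Y i t) = a t + I n" for n
      by (simp only: sum.lessThan_Suc_shift Y0)
    moreover have "(\<lambda>n. \<Sum>i<Suc n. Y i t) \<longlonglongrightarrow> y t"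
      using tendsto_uniform_limitI[OF unif, of t t] t by (intro LIMSEQ_Suc) auto
    ultimately have "(\<lambda>n. a t + I n) \<longlonglongrightarrow> y t"
      by simp
    moreover have "(\<lambda>n. a t + I n) \<longlonglongrightarrow> a t + J"
      by (intro tendsto_intros IJ)
    ultimately have "y t = a t + J"
      using LIMSEQ_unique by blast
    then show ?thesis
      using J by (simp add: integral_unique)
  qed
  ultimately show ?thesis
    using that by blast
qed

text \<open>The differential equation is solved in integrated form, which absorbs the jumps of \<open>f\<close> into the
  continuous function \<open>\<integral> f\<close>. The right derivative then exists at every time because the integrand is
  right-continuous.\<close>

lemma linear_ode_solution:
  fixes M :: "real ^ 's ^ 's" and f :: "real \<Rightarrow> real ^ 's"
  assumes f: "f \<in> signals"
  obtains \<xi> where "state_trajectory \<xi> (\<lambda>t\<in>{0..}. M *v \<xi> t + f t)" and "\<xi> 0 = 0"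
proof -
  let ?L = "(*v) M"
  have f': "piecewise_rcont f"
    using f by (rule signals_imp_piecewise_rcont)
  have intf: "f integrable_on {0..T}" for T
    using f' by (rule piecewise_rcont_integrable) simp
  obtain y where y: "continuous_on {0..} y"
    and eq: "\<And>t. t \<ge> 0 \<Longrightarrow> y t = integral {0..t} f + integral {0..t} (\<lambda>s. M *v y s)"
    using linear_volterra_solution[OF matrix_vector_mul_bounded_linear continuous_on_integral_upper_limit[OF intf]]
    by blast
  define \<xi> where "\<xi> = (\<lambda>t\<in>{0..}. y t)"
  let ?g = "\<lambda>t\<in>{0..}. M *v \<xi> t + f t"
  have \<xi>: "\<xi> \<in> extensional {0..}" "continuous_on {0..} \<xi>"
    unfolding \<xi>_def by (auto intro: continuous_on_eq[OF y])
  have g: "?g \<in> signals"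
    using signals_add[OF signals_mult[OF signals_continuous[OF \<xi>], of M] f]
    by (simp cong: restrict_cong)
  have \<xi>_eq: "\<xi> t = integral {0..t} ?g" if t: "t \<ge> 0" for t
  proof -
    have "integral {0..t} (\<lambda>s. f s + M *v y s) = integral {0..t} f + integral {0..t} (\<lambda>s. M *v y s)"
    proof (intro Henstock_Kurzweil_Integration.integral_add intf integrable_continuous_real)
      show "continuous_on {0..t} (\<lambda>s. M *v y s)"
        by (rule bounded_linear.continuous_on[OF matrix_vector_mul_bounded_linear
              continuous_on_subset[OF y]]) auto
    qed
    then have "\<xi> t = integral {0..t} (\<lambda>s. f s + M *v y s)"
      using t eq by (simp add: \<xi>_def)
    also have "\<dots> = integral {0..t} ?g"
      by (rule integral_cong) (simp add: \<xi>_def add.commute)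
    finally show ?thesis .
  qed
  have "(\<xi> has_vector_derivative ?g t) (at t within {t..})" if t: "t \<ge> 0" for t
    by (rule has_vector_derivative_transform[OF _ _ piecewise_rcont_integral_right_derivative
          [OF signals_imp_piecewise_rcont[OF g] t]])
       (use t \<xi>_eq in auto)
  then have "state_trajectory \<xi> ?g"
    using \<xi> g by (simp add: state_trajectory_def)
  moreover have "\<xi> 0 = 0"
    using \<xi>_eq[of 0] by simp
  ultimately show ?thesis
    using that by blast
qed

lemma filter_response_exists:
  assumes z: "z \<in> signals" and w: "w \<in> signals"
  obtains \<xi> v where "filter_response A\<Psi> B\<Psi>1 B\<Psi>2 C\<Psi> D\<Psi>1 D\<Psi>2 z w \<xi> v"
proof -
  have sum: "(\<lambda>t\<in>{0..}. M *v z t + N *v w t) \<in> signals" for M N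
    using signals_add[OF signals_mult[OF z, of M] signals_mult[OF w, of N]]
    by (simp cong: restrict_cong)
  obtain \<xi> where \<xi>: "state_trajectory \<xi>
      (\<lambda>t\<in>{0..}. A\<Psi> *v \<xi> t + (\<lambda>t\<in>{0..}. B\<Psi>1 *v z t + B\<Psi>2 *v w t) t)" "\<xi> 0 = 0"
    using linear_ode_solution[OF sum] by blast
  have "\<xi> \<in> signals"
    using \<xi>(1) by (auto simp: state_trajectory_def intro: signals_continuous)
  then have "(\<lambda>t\<in>{0..}. C\<Psi> *v \<xi> t + D\<Psi>1 *v z t + D\<Psi>2 *v w t) \<in> signals"
    using signals_add[OF signals_mult sum, of \<xi> C\<Psi> D\<Psi>1 D\<Psi>2]
    by (simp add: add.assoc cong: restrict_cong)
  then have "filter_response A\<Psi> B\<Psi>1 B\<Psi>2 C\<Psi> D\<Psi>1 D\<Psi>2 z w \<xi>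
      (\<lambda>t\<in>{0..}. C\<Psi> *v \<xi> t + D\<Psi>1 *v z t + D\<Psi>2 *v w t)"
    using \<xi> unfolding filter_response_def by (fastforce simp: add.assoc)
  then show ?thesis
    using that by blast
qed

section \<open>Block matrices and Schur complements\<close>

lemma vcat_nth [simp]: "vcat u v $ Inl i = u $ i" "vcat u v $ Inr j = v $ j"
  by (simp_all add: vcat_def)

lemma sum_UNIV_sum_type:
  "(\<Sum>i\<in>(UNIV :: ('a::finite + 'b::finite) set). f i) = (\<Sum>a\<in>UNIV. f (Inl a)) + (\<Sum>b\<in>UNIV. f (Inr b))"
  by (simp add: UNIV_Plus_UNIV[symmetric] sum.Plus o_def del: UNIV_Plus_UNIV)

lemma vcat_eqI: "(\<And>i. x $ Inl i = u $ i) \<Longrightarrow> (\<And>j. x $ Inr j = v $ j) \<Longrightarrow> x = vcat u v"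
  by (simp add: vec_eq_iff split_sum_all)

lemma vcat_add: "vcat a b + vcat c d = vcat (a + c) (b + d)"
  by (rule vcat_eqI) simp_all

lemma vcat_zero [simp]: "vcat 0 0 = 0"
  by (rule vcat_eqI[symmetric]) simp_all

lemma inner_vcat: "vcat a b \<bullet> vcat c d = a \<bullet> c + b \<bullet> (d :: real ^ 'n)"
  by (simp add: inner_vec_def sum_UNIV_sum_type)

lemma norm_vcat: "(norm (vcat a b :: real ^ ('m::finite + 'n::finite)))\<^sup>2 = (norm a)\<^sup>2 + (norm b)\<^sup>2"
  by (simp add: power2_norm_eq_inner inner_vcat)

lemma vcat_mult: "vcat M N *v u = vcat (M *v u) (N *v u)"
  by (rule vcat_eqI) (simp_all add: matrix_vector_mult_def)

lemma hcat_mult: "hcat M N *v vcat u v = M *v u + N *v v"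
  by (simp add: vec_eq_iff matrix_vector_mult_def hcat_def sum_UNIV_sum_type)

lemma block_mult:
  "block M11 M12 M21 M22 *v vcat u v = vcat (M11 *v u + M12 *v v) (M21 *v u + M22 *v v)"
  by (simp add: block_def vcat_mult hcat_mult)

lemma bounded_linear_vcat: "bounded_linear (\<lambda>p. vcat (fst p) (snd p) :: real ^ ('m::finite + 'n::finite))"
  unfolding linear_conv_bounded_linear[symmetric]
  by (rule linearI) (auto simp: vcat_add intro!: vcat_eqI[symmetric])

lemma inner_transpose_mult: "x \<bullet> (transpose M *v y) = (M *v x) \<bullet> (y :: real ^ 'm)"
  by (metis dot_lmul_matrix inner_commute transpose_matrix_vector)

lemma transpose_minus: "transpose (M - N) = transpose M - transpose (N :: real ^ 'a ^ 'b)"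
  by (simp add: transpose_def vec_eq_iff)

lemma symmetric_mat_inner: "symmetric_mat M \<Longrightarrow> x \<bullet> (M *v y) = (M *v x) \<bullet> y"
  by (metis inner_transpose_mult symmetric_mat_def)

lemma inner_congruence: "x \<bullet> ((transpose M ** Y ** M) *v x) = (M *v x) \<bullet> (Y *v (M *v x))"
  for M :: "real ^ 'a ^ 'b"
  by (simp add: matrix_vector_mul_assoc[symmetric] inner_transpose_mult del: transpose_matrix_vector)

text \<open>The margin \<open>\<epsilon>\<close> is minus the maximum of the quadratic form over the compact unit sphere.\<close>

lemma neg_def_coercive:
  fixes M :: "real ^ 'n ^ 'n"
  assumes "neg_def M"
  obtains \<epsilon> where "\<epsilon> > 0" and "\<And>x. x \<bullet> (M *v x) + \<epsilon> * (norm x)\<^sup>2 \<le> 0"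
proof -
  let ?q = "\<lambda>x. x \<bullet> (M *v x)"
  have "compact (sphere 0 1 :: (real ^ 'n) set)" "(sphere 0 1 :: (real ^ 'n) set) \<noteq> {}"
    by simp_all
  moreover have "continuous_on (sphere 0 1) ?q"
    by (intro continuous_intros matrix_vector_mult_linear_continuous_on)
  ultimately obtain y where y: "norm y = 1" "\<And>x. norm x = 1 \<Longrightarrow> ?q x \<le> ?q y"
    using continuous_attains_sup[of "sphere 0 1" ?q] by auto
  \<comment> \<open>By homogeneity, the bound on the sphere carries over to every \<open>x \<noteq> 0\<close>.\<close>
  have "?q x + - ?q y * (norm x)\<^sup>2 \<le> 0" for x
  proof (cases "x = 0")
    case False
    have "norm (x /\<^sub>R norm x) = 1"
      using False by simp
    then have "?q (x /\<^sub>R norm x) \<le> ?q y"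
      by (rule y(2))
    then show ?thesis
      using False by (simp add: matrix_vector_mult_scaleR field_simps power2_eq_square)
  qed simp
  moreover have "- ?q y > 0"
    using assms y(1) unfolding neg_def_def by (metis neg_0_less_iff_less norm_zero zero_neq_one)
  ultimately show ?thesis
    using that by blast
qed

lemma matrix_inv_right: "invertible M \<Longrightarrow> M ** matrix_inv M = mat 1"
  unfolding invertible_def matrix_inv_def by (rule someI_ex[THEN conjunct1])

lemma pos_def_imp_invertible:
  fixes M :: "real ^ 'n ^ 'n"
  assumes "pos_def M"
  shows "invertible M"
proof -
  have "x = 0" if "M *v x = 0" for x
    using assms that unfolding pos_def_def by (metis inner_zero_right less_irrefl)
  then show ?thesis
    by (simp add: invertible_left_inverse matrix_left_invertible_ker)
qed

lemma symmetric_mat_block: "symmetric_mat (block M N (transpose N) K) \<longleftrightarrow> symmetric_mat M \<and> symmetric_mat K"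
  by (auto simp: symmetric_mat_def transpose_def block_def hcat_def vec_eq_iff split_sum_all)

lemma block_quadratic_form:
  "vcat \<xi> x \<bullet> (block M N (transpose N) K *v vcat \<xi> x) = \<xi> \<bullet> (M *v \<xi>) + 2 * (\<xi> \<bullet> (N *v x)) + x \<bullet> (K *v (x :: real ^ 'n))"
  by (simp add: block_mult inner_vcat inner_add_right inner_transpose_mult inner_commute del: transpose_matrix_vector)

text \<open>For a positive definite block matrix, completing the square in the upper variable leaves the
  quadratic form of the Schur complement in the lower one. It is therefore the minimum of the full
  form over the upper variable, attained at \<open>\<xi> = - M\<^sup>-\<^sup>1 N x\<close>, and inherits positivity.\<close>

context
  fixes M :: "real ^ 's ^ 's" and N :: "real ^ 'n ^ 's" and K :: "real ^ 'n ^ 'n"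
  assumes pos: "pos_def (block M N (transpose N) K)"
begin

lemma pos_def_upper_block: "pos_def M"
  unfolding pos_def_def
proof (intro conjI allI impI)
  show "symmetric_mat M"
    using pos by (simp add: pos_def_def symmetric_mat_block)
  fix \<xi> :: "real ^ 's" assume "\<xi> \<noteq> 0"
  then have "vcat \<xi> (0 :: real ^ 'n) \<noteq> 0"
    by (metis vcat_nth(1) vec_eq_iff zero_index)
  then have "vcat \<xi> 0 \<bullet> (block M N (transpose N) K *v vcat \<xi> 0) > 0"
    using pos unfolding pos_def_def by blast
  then show "\<xi> \<bullet> (M *v \<xi>) > 0"
    by (simp add: block_quadratic_form)
qed

lemma schur_complete_square:
  defines "\<zeta> \<equiv> \<lambda>x. matrix_inv M *v (N *v x)"
  shows "vcat \<xi> x \<bullet> (block M N (transpose N) K *v vcat \<xi> x)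
    = (\<xi> + \<zeta> x) \<bullet> (M *v (\<xi> + \<zeta> x)) + x \<bullet> ((K - transpose N ** matrix_inv M ** N) *v x)"
proof -
  have M\<zeta>: "M *v \<zeta> x = N *v x"
    using matrix_inv_right[OF pos_def_imp_invertible[OF pos_def_upper_block]]
    by (simp add: \<zeta>_def matrix_vector_mul_assoc matrix_mul_assoc)
  have "\<zeta> x \<bullet> (M *v \<xi>) = \<xi> \<bullet> (N *v x)"
    using symmetric_mat_inner[of M "\<zeta> x" \<xi>] pos_def_upper_block M\<zeta>
    by (simp add: pos_def_def inner_commute)
  moreover have "x \<bullet> ((transpose N ** matrix_inv M ** N) *v x) = \<zeta> x \<bullet> (N *v x)"
    by (simp add: matrix_vector_mul_assoc[symmetric] inner_transpose_mult \<zeta>_def inner_commute del: transpose_matrix_vector)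
  ultimately show ?thesis
    by (simp add: block_quadratic_form matrix_vector_right_distrib M\<zeta> inner_add
        matrix_vector_mult_diff_rdistrib inner_diff_right)
qed

lemma schur_complement_le:
  "x \<bullet> ((K - transpose N ** matrix_inv M ** N) *v x)
    \<le> vcat \<xi> x \<bullet> (block M N (transpose N) K *v vcat \<xi> x)"
  using pos_def_upper_block unfolding schur_complete_square pos_def_def
  by (metis (no_types) add_increasing inner_zero_left less_imp_le order_refl)

lemma schur_complement_pos_def: "pos_def (K - transpose N ** matrix_inv M ** N)"
  unfolding pos_def_def
proof (intro conjI allI impI)
  have M: "symmetric_mat M" "symmetric_mat K"
    using pos by (simp_all add: pos_def_def symmetric_mat_block)
  have "transpose (matrix_inv M) = matrix_inv M"
  proof -
    have inv: "invertible M"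
      by (rule pos_def_imp_invertible[OF pos_def_upper_block])
    have "transpose (matrix_inv M) ** M = mat 1"
      using matrix_inv_right[OF inv] M(1) by (metis matrix_transpose_mul symmetric_mat_def transpose_mat)
    then show ?thesis
      using matrix_inv_right[OF inv] by (metis matrix_mul_assoc matrix_mul_lid matrix_mul_rid)
  qed
  then show "symmetric_mat (K - transpose N ** matrix_inv M ** N)"
    using M(2) by (simp add: symmetric_mat_def transpose_minus matrix_transpose_mul matrix_mul_assoc)
  fix x :: "real ^ 'n" assume "x \<noteq> 0"
  let ?\<xi> = "- (matrix_inv M *v (N *v x))"
  have "vcat ?\<xi> x \<noteq> 0"
    using \<open>x \<noteq> 0\<close> by (metis vcat_nth(2) vec_eq_iff zero_index)
  then have "vcat ?\<xi> x \<bullet> (block M N (transpose N) K *v vcat ?\<xi> x) > 0"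
    using pos unfolding pos_def_def by blast
  then show "x \<bullet> ((K - transpose N ** matrix_inv M ** N) *v x) > 0"
    by (simp add: schur_complete_square)
qed

end

section \<open>Dissipation along trajectories\<close>

lemma piecewise_rcont_vcat:
  fixes f :: "real \<Rightarrow> real ^ 'a" and g :: "real \<Rightarrow> real ^ 'b"
  assumes "piecewise_rcont f" and "piecewise_rcont g"
  shows "piecewise_rcont (\<lambda>t. vcat (f t) (g t))"
  using piecewise_rcont_compose[OF piecewise_rcont_Pair[OF assms]
      linear_continuous_on[OF bounded_linear_vcat]]
  by simp

lemma piecewise_rcont_quadratic_form:
  fixes u :: "real \<Rightarrow> real ^ 'a"
  assumes "piecewise_rcont u"
  shows "piecewise_rcont (\<lambda>t. u t \<bullet> (M *v u t))"
  by (rule piecewise_rcont_compose[OF assms])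
     (intro continuous_intros matrix_vector_mult_linear_continuous_on)

lemma piecewise_rcont_norm_square:
  fixes u :: "real \<Rightarrow> real ^ 'a"
  assumes "piecewise_rcont u"
  shows "piecewise_rcont (\<lambda>t. (norm (u t))\<^sup>2)"
  by (rule piecewise_rcont_compose[OF assms]) (intro continuous_intros)

text \<open>The left-hand side, as a function of \<open>T\<close>, is continuous and has a nonpositive right derivative, so
  it does not exceed its value at \<open>T = 0\<close>.\<close>

lemma dissipation_inequality:
  fixes \<eta> \<eta>' :: "real \<Rightarrow> real ^ 'a" and q :: "real \<Rightarrow> real"
  assumes T: "0 \<le> T" and \<eta>: "continuous_on {0..} \<eta>" and q: "piecewise_rcont q"
    and der: "\<And>t. t \<ge> 0 \<Longrightarrow> (\<eta> has_vector_derivative \<eta>' t) (at t within {t..})"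
    and le: "\<And>t. t \<ge> 0 \<Longrightarrow> \<eta>' t \<bullet> (X *v \<eta> t) + \<eta> t \<bullet> (X *v \<eta>' t) + q t \<le> 0"
  shows "\<eta> T \<bullet> (X *v \<eta> T) + integral {0..T} q \<le> \<eta> 0 \<bullet> (X *v \<eta> 0)"
proof -
  let ?W = "\<lambda>t. \<eta> t \<bullet> (X *v \<eta> t) + integral {0..t} q"
  have "?W T \<le> ?W 0"
  proof (rule right_derivative_nonpos_imp_le[where g = ?W and a = 0 and b = T])
    have "continuous_on {0..} ?W"
      by (intro continuous_intros \<eta> bounded_linear.continuous_on[OF matrix_vector_mul_bounded_linear]
          continuous_on_integral_upper_limit piecewise_rcont_integrable[OF q]) simp
    then show "continuous_on {0..T} ?W"
      by (rule continuous_on_subset) auto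
    show "(?W has_vector_derivative (\<eta> t \<bullet> (X *v \<eta>' t) + \<eta>' t \<bullet> (X *v \<eta> t)) + q t) (at t within {t..})"
      if "0 \<le> t" "t < T" for t
      using that(1)
      by (intro has_vector_derivative_add piecewise_rcont_integral_right_derivative[OF q]
          bounded_bilinear.has_vector_derivative[OF bounded_bilinear_inner]
          bounded_linear.has_vector_derivative[OF matrix_vector_mul_bounded_linear] der)
    show "(\<eta> t \<bullet> (X *v \<eta>' t) + \<eta>' t \<bullet> (X *v \<eta> t)) + q t \<le> 0" if "0 \<le> t" "t < T" for t
      using le[OF that(1)] by linarith
  qed (use T in auto)
  then show ?thesis
    by simp
qed

text \<open>The infinitesimal form of the dissipation inequality at a single instant: \<open>\<xi>'\<close> and \<open>x'\<close> are the
  velocities that the filter and the plant assign to the point \<open>(\<xi>, x, w, d)\<close>, and the first two terms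
  are the rate of change of the storage \<open>(\<xi>, x)\<^sup>T X (\<xi>, x)\<close>.\<close>

definition storage_dissipates ::
  "real ^ 'n ^ 'n \<Rightarrow> real ^ 'm ^ 'n \<Rightarrow> real ^ 'd ^ 'n
    \<Rightarrow> real ^ 'n ^ 'k \<Rightarrow> real ^ 'm ^ 'k \<Rightarrow> real ^ 'd ^ 'k
    \<Rightarrow> real ^ 'n ^ 'e \<Rightarrow> real ^ 'm ^ 'e \<Rightarrow> real ^ 'd ^ 'e
    \<Rightarrow> real ^ 's ^ 's \<Rightarrow> real ^ 'k ^ 's \<Rightarrow> real ^ 'm ^ 's
    \<Rightarrow> real ^ 's ^ 'p \<Rightarrow> real ^ 'k ^ 'p \<Rightarrow> real ^ 'm ^ 'p
    \<Rightarrow> real ^ ('s + 'n) ^ ('s + 'n) \<Rightarrow> real ^ 'p ^ 'p \<Rightarrow> real ^ ('e + 'd) ^ ('e + 'd)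
    \<Rightarrow> real \<Rightarrow> bool"
where
  "storage_dissipates A B Bd C D Dd Ce De Ded A\<Psi> B\<Psi>1 B\<Psi>2 C\<Psi> D\<Psi>1 D\<Psi>2 X P Pp \<epsilon> \<longleftrightarrow>
     (\<forall>\<xi> x w d \<xi>' x' z v e.
       x' = A *v x + B *v w + Bd *v d \<and> z = C *v x + D *v w + Dd *v d \<and>
       e = Ce *v x + De *v w + Ded *v d \<and>
       \<xi>' = A\<Psi> *v \<xi> + B\<Psi>1 *v z + B\<Psi>2 *v w \<and>
       v = C\<Psi> *v \<xi> + D\<Psi>1 *v z + D\<Psi>2 *v w \<longrightarrow>
       vcat \<xi>' x' \<bullet> (X *v vcat \<xi> x) + vcat \<xi> x \<bullet> (X *v vcat \<xi>' x')
         + (v \<bullet> (P *v v) + vcat e d \<bullet> (Pp *v vcat e d)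
            + \<epsilon> * ((norm x)\<^sup>2 + (norm w)\<^sup>2)) \<le> 0)"

text \<open>The three outer factors of the matrix inequality map \<open>\<zeta> = (\<xi>, x, w, d)\<close> to the velocities and
  states, to the filter output and to the performance signals. Evaluating the negative definite form at
  \<open>\<zeta>\<close> gives the pointwise inequality.\<close>

lemma lmi_imp_storage_dissipates:
  fixes A :: "real ^ 'n ^ 'n" and B :: "real ^ 'm ^ 'n" and Bd :: "real ^ 'd ^ 'n"
    and C :: "real ^ 'n ^ 'k" and D :: "real ^ 'm ^ 'k" and Dd :: "real ^ 'd ^ 'k"
    and Ce :: "real ^ 'n ^ 'e" and De :: "real ^ 'm ^ 'e" and Ded :: "real ^ 'd ^ 'e"
    and A\<Psi> :: "real ^ 's ^ 's" and B\<Psi>1 :: "real ^ 'k ^ 's" and B\<Psi>2 :: "real ^ 'm ^ 's"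
    and C\<Psi> :: "real ^ 's ^ 'p" and D\<Psi>1 :: "real ^ 'k ^ 'p" and D\<Psi>2 :: "real ^ 'm ^ 'p"
  defines "F \<equiv> block (block A\<Psi> (B\<Psi>1 ** C) 0 A) (block (B\<Psi>1 ** D + B\<Psi>2) (B\<Psi>1 ** Dd) B Bd) (mat 1) 0"
    and "G \<equiv> hcat (hcat C\<Psi> (D\<Psi>1 ** C)) (hcat (D\<Psi>1 ** D + D\<Psi>2) (D\<Psi>1 ** Dd))"
    and "H \<equiv> block (hcat 0 Ce) (hcat De Ded) 0 (hcat 0 (mat 1))"
  assumes "neg_def (transpose F ** block 0 X X 0 ** F + transpose G ** P ** G + transpose H ** Pp ** H)"
  obtains \<epsilon> where "\<epsilon> > 0"
    and "storage_dissipates A B Bd C D Dd Ce De Ded A\<Psi> B\<Psi>1 B\<Psi>2 C\<Psi> D\<Psi>1 D\<Psi>2 X P Pp \<epsilon>"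
proof -
  obtain \<epsilon> where \<epsilon>: "\<epsilon> > 0" "\<And>\<zeta>. \<zeta> \<bullet> ((transpose F ** block 0 X X 0 ** F + transpose G ** P ** G
      + transpose H ** Pp ** H) *v \<zeta>) + \<epsilon> * (norm \<zeta>)\<^sup>2 \<le> 0"
    using neg_def_coercive[OF assms(4)] by blast
  have "vcat \<xi>' x' \<bullet> (X *v vcat \<xi> x) + vcat \<xi> x \<bullet> (X *v vcat \<xi>' x')
      + (v \<bullet> (P *v v) + vcat e d \<bullet> (Pp *v vcat e d) + \<epsilon> * ((norm x)\<^sup>2 + (norm w)\<^sup>2)) \<le> 0"
    if x': "x' = A *v x + B *v w + Bd *v d" and z: "z = C *v x + D *v w + Dd *v d"
      and e: "e = Ce *v x + De *v w + Ded *v d"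
      and \<xi>': "\<xi>' = A\<Psi> *v \<xi> + B\<Psi>1 *v z + B\<Psi>2 *v w" and v: "v = C\<Psi> *v \<xi> + D\<Psi>1 *v z + D\<Psi>2 *v w"
    for \<xi> x w d \<xi>' x' z v e
  proof -
    let ?\<zeta> = "vcat (vcat \<xi> x) (vcat w d)"
    have F: "F *v ?\<zeta> = vcat (vcat \<xi>' x') (vcat \<xi> x)"
      unfolding F_def x' \<xi>' z
      by (simp add: block_mult vcat_add matrix_vector_right_distrib matrix_vector_mult_add_rdistrib
          matrix_vector_mul_assoc add_ac)
    have G: "G *v ?\<zeta> = v"
      unfolding G_def v z
      by (simp add: hcat_mult matrix_vector_right_distrib matrix_vector_mult_add_rdistrib
          matrix_vector_mul_assoc add_ac)
    have H: "H *v ?\<zeta> = vcat e d"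
      unfolding H_def e by (simp add: block_mult hcat_mult add_ac)
    have "(norm x)\<^sup>2 + (norm w)\<^sup>2 \<le> (norm ?\<zeta>)\<^sup>2"
      by (simp add: norm_vcat)
    then have "\<epsilon> * ((norm x)\<^sup>2 + (norm w)\<^sup>2) \<le> \<epsilon> * (norm ?\<zeta>)\<^sup>2"
      using \<epsilon>(1) by (intro mult_left_mono) auto
    then show ?thesis
      using \<epsilon>(2)[of ?\<zeta>]
      by (simp add: matrix_vector_mult_add_rdistrib inner_add_right inner_congruence F G H
          block_mult inner_vcat)
  qed
  then have "storage_dissipates A B Bd C D Dd Ce De Ded A\<Psi> B\<Psi>1 B\<Psi>2 C\<Psi> D\<Psi>1 D\<Psi>2 X P Pp \<epsilon>"
    unfolding storage_dissipates_def by blast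
  then show ?thesis
    by (rule that[OF \<epsilon>(1)])
qed

text \<open>Adding the IQC to the integrated dissipation inequality turns the term \<open>\<integral> v\<^sup>T P v\<close> into the terminal
  cost of \<open>\<xi>T\<close>, the state of the filter at time \<open>T\<close>. That state is only known to exist, which is why the
  conclusion is existential in it.\<close>

lemma interconnection_dissipation:
  fixes X1 Z :: "real ^ 's ^ 's" and X12 :: "real ^ 'n ^ 's" and X2 :: "real ^ 'n ^ 'n"
  defines "X \<equiv> block X1 X12 (transpose X12) X2"
  assumes sys: "interconnection A B Bd C D Dd Ce De Ded \<Delta> x w d z e"
    and iqc: "terminal_cost A\<Psi> B\<Psi>1 B\<Psi>2 C\<Psi> D\<Psi>1 D\<Psi>2 \<Delta> P Z"
    and diss: "storage_dissipates A B Bd C D Dd Ce De Ded A\<Psi> B\<Psi>1 B\<Psi>2 C\<Psi> D\<Psi>1 D\<Psi>2 X P Pp \<epsilon>"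
    and T: "0 \<le> T"
  obtains \<xi>T where "vcat \<xi>T (x T) \<bullet> (block (X1 + Z) X12 (transpose X12) X2 *v vcat \<xi>T (x T))
      + integral {0..T} (\<lambda>t. vcat (e t) (d t) \<bullet> (Pp *v vcat (e t) (d t)))
      + \<epsilon> * (integral {0..T} (\<lambda>t. (norm (x t))\<^sup>2) + integral {0..T} (\<lambda>t. (norm (w t))\<^sup>2))
    \<le> x 0 \<bullet> (X2 *v x 0)"
proof -
  have w: "w \<in> signals" and z: "z \<in> signals" and d: "d \<in> signals" and e: "e \<in> signals"
    and \<Delta>: "w \<in> \<Delta> z"
    and z_eq: "\<And>t. t \<ge> 0 \<Longrightarrow> z t = C *v x t + D *v w t + Dd *v d t"
    and e_eq: "\<And>t. t \<ge> 0 \<Longrightarrow> e t = Ce *v x t + De *v w t + Ded *v d t"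
    using sys by (auto simp: interconnection_def)
  obtain x' where x: "state_trajectory x x'"
    and x': "\<And>t. t \<ge> 0 \<Longrightarrow> x' t = A *v x t + B *v w t + Bd *v d t"
    using sys by (auto simp: interconnection_def)
  obtain \<xi> v where filter: "filter_response A\<Psi> B\<Psi>1 B\<Psi>2 C\<Psi> D\<Psi>1 D\<Psi>2 z w \<xi> v"
    using filter_response_exists[OF z w] by blast
  then obtain \<xi>' where \<xi>: "state_trajectory \<xi> \<xi>'"
    and \<xi>': "\<And>t. t \<ge> 0 \<Longrightarrow> \<xi>' t = A\<Psi> *v \<xi> t + B\<Psi>1 *v z t + B\<Psi>2 *v w t"
    and \<xi>0: "\<xi> 0 = 0" and v: "v \<in> signals"
    and v_eq: "\<And>t. t \<ge> 0 \<Longrightarrow> v t = C\<Psi> *v \<xi> t + D\<Psi>1 *v z t + D\<Psi>2 *v w t"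
    by (auto simp: filter_response_def)
  have cost: "\<xi> T \<bullet> (Z *v \<xi> T) \<le> integral {0..T} (\<lambda>t. v t \<bullet> (P *v v t))"
    using iqc w z \<Delta> filter T unfolding terminal_cost_def by fastforce
  let ?\<eta> = "\<lambda>t. vcat (\<xi> t) (x t)"
  let ?s = "\<lambda>t. v t \<bullet> (P *v v t)"
  let ?p = "\<lambda>t. vcat (e t) (d t) \<bullet> (Pp *v vcat (e t) (d t))"
  have s: "piecewise_rcont ?s"
    by (intro piecewise_rcont_quadratic_form signals_imp_piecewise_rcont v)
  have p: "piecewise_rcont ?p"
    by (intro piecewise_rcont_quadratic_form piecewise_rcont_vcat signals_imp_piecewise_rcont e d)
  have x2: "piecewise_rcont (\<lambda>t. (norm (x t))\<^sup>2)"
    by (intro piecewise_rcont_norm_square state_trajectory_imp_piecewise_rcont[OF x])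
  have w2: "piecewise_rcont (\<lambda>t. (norm (w t))\<^sup>2)"
    by (intro piecewise_rcont_norm_square signals_imp_piecewise_rcont w)
  have n: "piecewise_rcont (\<lambda>t. \<epsilon> * ((norm (x t))\<^sup>2 + (norm (w t))\<^sup>2))"
    by (rule piecewise_rcont_compose[OF piecewise_rcont_add[OF x2 w2]]) (intro continuous_intros)
  let ?q = "\<lambda>t. ?s t + ?p t + \<epsilon> * ((norm (x t))\<^sup>2 + (norm (w t))\<^sup>2)"
  have int: "f integrable_on {0..T}" if "piecewise_rcont f" for f :: "real \<Rightarrow> real"
    using that by (rule piecewise_rcont_integrable) simp
  have "?\<eta> T \<bullet> (X *v ?\<eta> T) + integral {0..T} ?q \<le> ?\<eta> 0 \<bullet> (X *v ?\<eta> 0)"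
  proof (rule dissipation_inequality[OF T, where \<eta>' = "\<lambda>t. vcat (\<xi>' t) (x' t)"])
    show "continuous_on {0..} ?\<eta>"
      using bounded_linear.continuous_on[OF bounded_linear_vcat continuous_on_Pair[of "{0..}" \<xi> x]] \<xi> x
      by (simp add: state_trajectory_def)
    show "piecewise_rcont ?q"
      by (intro piecewise_rcont_add s p n)
    show "(?\<eta> has_vector_derivative vcat (\<xi>' t) (x' t)) (at t within {t..})" if "t \<ge> 0" for t
      using bounded_linear.has_vector_derivative[OF bounded_linear_vcat has_vector_derivative_Pair] \<xi> x that
      by (fastforce simp: state_trajectory_def)
    show "vcat (\<xi>' t) (x' t) \<bullet> (X *v ?\<eta> t) + ?\<eta> t \<bullet> (X *v vcat (\<xi>' t) (x' t)) + ?q t \<le> 0"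
      if "t \<ge> 0" for t
      using diss x'[OF that] z_eq[OF that] e_eq[OF that] \<xi>'[OF that] v_eq[OF that]
      unfolding storage_dissipates_def by blast
  qed
  moreover have "integral {0..T} ?q = integral {0..T} ?s + integral {0..T} ?p
      + \<epsilon> * (integral {0..T} (\<lambda>t. (norm (x t))\<^sup>2) + integral {0..T} (\<lambda>t. (norm (w t))\<^sup>2))"
    using int[OF s] int[OF p] int[OF x2] int[OF w2] int[OF n]
    by (simp add: Henstock_Kurzweil_Integration.integral_add integrable_add)
  ultimately have "?\<eta> T \<bullet> (block (X1 + Z) X12 (transpose X12) X2 *v ?\<eta> T) + integral {0..T} ?p
      + \<epsilon> * (integral {0..T} (\<lambda>t. (norm (x t))\<^sup>2) + integral {0..T} (\<lambda>t. (norm (w t))\<^sup>2))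
    \<le> x 0 \<bullet> (X2 *v x 0)"
    using cost \<xi>0 unfolding X_def block_quadratic_form
    by (simp add: matrix_vector_mult_add_rdistrib inner_add_right)
  then show ?thesis
    by (rule that)
qed

theorem theorem15:
  fixes A :: "real ^ 'n ^ 'n" and B :: "real ^ 'm ^ 'n" and Bd :: "real ^ 'd ^ 'n"
    and C :: "real ^ 'n ^ 'k" and D :: "real ^ 'm ^ 'k" and Dd :: "real ^ 'd ^ 'k"
    and Ce :: "real ^ 'n ^ 'e" and De :: "real ^ 'm ^ 'e" and Ded :: "real ^ 'd ^ 'e"
    and \<Delta> :: "(real \<Rightarrow> real ^ 'k) \<Rightarrow> (real \<Rightarrow> real ^ 'm) set"
    and Qp :: "real ^ 'e ^ 'e" and Sp :: "real ^ 'd ^ 'e" and Rp :: "real ^ 'd ^ 'd"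
    and Pp :: "real ^ ('e + 'd) ^ ('e + 'd)"
    and A\<Psi> :: "real ^ 's ^ 's" and B\<Psi>1 :: "real ^ 'k ^ 's" and B\<Psi>2 :: "real ^ 'm ^ 's"
    and C\<Psi> :: "real ^ 's ^ 'p" and D\<Psi>1 :: "real ^ 'k ^ 'p" and D\<Psi>2 :: "real ^ 'm ^ 'p"
    and PP :: "(real ^ 'p ^ 'p) set" and P :: "real ^ 'p ^ 'p"
    and Z X1 :: "real ^ 's ^ 's" and X12 :: "real ^ 'n ^ 's" and X2 :: "real ^ 'n ^ 'n"
    and X :: "real ^ ('s + 'n) ^ ('s + 'n)"
    and \<A> :: "real ^ ('s + 'n) ^ ('s + 'n)" and \<B> :: "real ^ ('m + 'd) ^ ('s + 'n)"
    and \<C> :: "real ^ ('s + 'n) ^ 'p" and \<D> :: "real ^ ('m + 'd) ^ 'p"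
    and F :: "real ^ (('s + 'n) + ('m + 'd)) ^ (('s + 'n) + ('s + 'n))"
    and G :: "real ^ (('s + 'n) + ('m + 'd)) ^ 'p"
    and H :: "real ^ (('s + 'n) + ('m + 'd)) ^ ('e + 'd)"
  assumes "uncertainty \<Delta>"
    and "Pp = block Qp Sp (transpose Sp) Rp" and "symmetric_mat Pp" and "pos_semidef Qp"
    and "\<forall>Q\<in>PP. symmetric_mat Q"
    and "\<A> = block A\<Psi> (B\<Psi>1 ** C) 0 A"
    and "\<B> = block (B\<Psi>1 ** D + B\<Psi>2) (B\<Psi>1 ** Dd) B Bd"
    and "\<C> = hcat C\<Psi> (D\<Psi>1 ** C)"
    and "\<D> = hcat (D\<Psi>1 ** D + D\<Psi>2) (D\<Psi>1 ** Dd)"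
    and "F = block \<A> \<B> (mat 1) 0"
    and "G = hcat \<C> \<D>"
    and "H = block (hcat 0 Ce) (hcat De Ded) 0 (hcat 0 (mat 1))"
    and "iqc_terminal_cost A\<Psi> B\<Psi>1 B\<Psi>2 C\<Psi> D\<Psi>1 D\<Psi>2 \<Delta> PP"
    and "P \<in> PP" and "terminal_cost A\<Psi> B\<Psi>1 B\<Psi>2 C\<Psi> D\<Psi>1 D\<Psi>2 \<Delta> P Z"
    and "X = block X1 X12 (transpose X12) X2" and "symmetric_mat X"
    and "pos_def (block (X1 + Z) X12 (transpose X12) X2)"
    and "neg_def (transpose F ** block 0 X X 0 ** F + transpose G ** P ** G
           + transpose H ** Pp ** H)"
  shows "(let E = X2 - transpose X12 ** matrix_inv (X1 + Z) ** X12 in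
      pos_def E \<and>
      (\<forall>x w d z e. interconnection A B Bd C D Dd Ce De Ded \<Delta> x w d z e \<longrightarrow>
        (\<forall>T\<ge>0. x T \<bullet> (E *v x T)
            + integral {0..T} (\<lambda>t. vcat (e t) (d t) \<bullet> (Pp *v vcat (e t) (d t)))
          \<le> x 0 \<bullet> (X2 *v x 0)))) \<and>
    robust_quadratic_performance A B Bd C D Dd Ce De Ded \<Delta> Pp \<and>
    robustly_stable A B C D \<Delta>"
proof -
  let ?Y = "block (X1 + Z) X12 (transpose X12) X2"
  define E where "E = X2 - transpose X12 ** matrix_inv (X1 + Z) ** X12"
  let ?perf = "\<lambda>e d T. integral {0..T} (\<lambda>t. vcat (e t) (d t) \<bullet> (Pp *v vcat (e t) (d t)))"
  let ?energy = "\<lambda>x w T. integral {0..T} (\<lambda>t. (norm (x t))\<^sup>2) + integral {0..T} (\<lambda>t. (norm (w t))\<^sup>2)"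
  have posE: "pos_def E"
    unfolding E_def by (rule schur_complement_pos_def) fact
  have E_le: "y \<bullet> (E *v y) \<le> vcat \<xi> y \<bullet> (?Y *v vcat \<xi> y)" for \<xi> y
    unfolding E_def by (rule schur_complement_le) fact
  have E_nonneg: "0 \<le> y \<bullet> (E *v y)" for y
    using posE by (cases "y = 0") (auto simp: pos_def_def less_imp_le)
  obtain \<epsilon> where \<epsilon>: "\<epsilon> > 0"
    and diss: "storage_dissipates A B Bd C D Dd Ce De Ded A\<Psi> B\<Psi>1 B\<Psi>2 C\<Psi> D\<Psi>1 D\<Psi>2 X P Pp \<epsilon>"
    by (rule lmi_imp_storage_dissipates[OF assms(19)[unfolded assms(10-12) assms(6-9)]])
  \<comment> \<open>The energy term is kept for stability; the performance estimates drop it.\<close>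
  have master: "x T \<bullet> (E *v x T) + ?perf e d T + \<epsilon> * ?energy x w T \<le> x 0 \<bullet> (X2 *v x 0)"
    if sys: "interconnection A B Bd C D Dd Ce De Ded \<Delta> x w d z e" and T: "T \<ge> 0" for x w d z e T
  proof -
    obtain \<xi>T where "vcat \<xi>T (x T) \<bullet> (?Y *v vcat \<xi>T (x T)) + ?perf e d T + \<epsilon> * ?energy x w T
        \<le> x 0 \<bullet> (X2 *v x 0)"
      by (rule interconnection_dissipation[OF sys assms(15)
            diss[unfolded assms(16)] T])
    then show ?thesis
      using E_le[of "x T" \<xi>T] by linarith
  qed
  have energy_nonneg: "0 \<le> ?energy x w T"
    if sys: "interconnection A B Bd C D Dd Ce De Ded \<Delta> x w d z e" for x w d z e T
  proof -
    obtain x' where "state_trajectory x x'" and "w \<in> signals"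
      using sys unfolding interconnection_def by blast
    then have "piecewise_rcont x" "piecewise_rcont w"
      by (auto intro: state_trajectory_imp_piecewise_rcont signals_imp_piecewise_rcont)
    then show ?thesis
      by (intro add_nonneg_nonneg Henstock_Kurzweil_Integration.integral_nonneg
          piecewise_rcont_integrable piecewise_rcont_norm_square) auto
  qed
  obtain K where K: "K > 0" "\<And>y. y \<bullet> (X2 *v y) \<le> K * (norm y)\<^sup>2"
  proof -
    obtain K where K: "K > 0" "\<And>y. norm (X2 *v y) \<le> norm y * K"
      using bounded_linear.pos_bounded[OF matrix_vector_mul_bounded_linear[of X2]] by blast
    have "y \<bullet> (X2 *v y) \<le> K * (norm y)\<^sup>2" for y
    proof -
      have "y \<bullet> (X2 *v y) \<le> norm y * norm (X2 *v y)"
        by (rule norm_cauchy_schwarz)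
      also have "\<dots> \<le> norm y * (norm y * K)"
        by (intro mult_left_mono K) simp
      finally show ?thesis
        by (simp add: power2_eq_square mult_ac)
    qed
    then show ?thesis
      using that K(1) by blast
  qed
  have bound: "x T \<bullet> (E *v x T) + ?perf e d T \<le> x 0 \<bullet> (X2 *v x 0)"
    if "interconnection A B Bd C D Dd Ce De Ded \<Delta> x w d z e" "T \<ge> 0" for x w d z e T
  proof -
    have "0 \<le> \<epsilon> * ?energy x w T"
      using \<epsilon> energy_nonneg[OF that(1)] by (intro mult_nonneg_nonneg) auto
    then show ?thesis
      using master[OF that] by linarith
  qed
  have performance: "?perf e d T \<le> K * (norm (x 0))\<^sup>2"
    if "interconnection A B Bd C D Dd Ce De Ded \<Delta> x w d z e" "T \<ge> 0" for x w d z e T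
    using bound[OF that] E_nonneg[of "x T"] K(2)[of "x 0"] by linarith
  have stability: "?energy x w T \<le> (sqrt (K / \<epsilon>))\<^sup>2 * (norm (x 0))\<^sup>2"
    if loop: "loop A B C D \<Delta> x w z" and T: "T \<ge> 0" for x w z T
  proof -
    obtain e where sys: "interconnection A B Bd C D Dd Ce De Ded \<Delta> x w (\<lambda>t\<in>{0..}. 0) z e"
      using loop loop_iff_interconnection by blast
    have ed: "e \<in> signals" "(\<lambda>t\<in>{0..}. 0 :: real ^ 'd) \<in> signals"
      using sys by (simp_all add: interconnection_def)
    have "0 \<le> ?perf e (\<lambda>t\<in>{0..}. 0 :: real ^ 'd) T"
    proof (rule Henstock_Kurzweil_Integration.integral_nonneg)
      show "(\<lambda>t. vcat (e t) ((\<lambda>t\<in>{0..}. 0) t) \<bullet> (Pp *v vcat (e t) ((\<lambda>t\<in>{0..}. 0 :: real ^ 'd) t)))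
          integrable_on {0..T}"
        by (intro piecewise_rcont_integrable piecewise_rcont_quadratic_form piecewise_rcont_vcat
            signals_imp_piecewise_rcont ed) simp
      show "0 \<le> vcat (e t) ((\<lambda>t\<in>{0..}. 0) t) \<bullet> (Pp *v vcat (e t) ((\<lambda>t\<in>{0..}. 0 :: real ^ 'd) t))"
        if "t \<in> {0..T}" for t
        using that assms(4) by (simp add: assms(2) block_quadratic_form pos_semidef_def)
    qed
    then have "\<epsilon> * ?energy x w T \<le> K * (norm (x 0))\<^sup>2"
      using master[OF sys T] E_nonneg[of "x T"] K(2)[of "x 0"] by linarith
    then show ?thesis
      using \<epsilon> K(1) by (simp add: pos_le_divide_eq mult.commute)
  qed
  have "sqrt (K / \<epsilon>) > 0"
    using K(1) \<epsilon> by simp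
  then have "robustly_stable A B C D \<Delta>"
    unfolding robustly_stable_def using stability by blast
  moreover have "robust_quadratic_performance A B Bd C D Dd Ce De Ded \<Delta> Pp"
    unfolding robust_quadratic_performance_def using performance K(1) by blast
  ultimately show ?thesis
    unfolding Let_def E_def[symmetric] using posE bound by blast
qed

end
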